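(* Let $\theta\in(0,\pi)$ with $\cos\theta=s/r$, where $r,s\in\mathbb{Z}$, $0\le|s|<r$, $\gcd(r,s)=1$. A natural number $n$ belongs to $\mathcal{N}_\theta$ if and only if the system $$E_\theta^w:\ y^2=x(x+(r+s)w)(x-(r-s)w),$$ $$G_\theta^N:\ z^2=\big(x^2+2s(N+w)x-(r^2-s^2)w^2\big)^2+4(r^2-s^2)N^2x^2,$$ where $N=2n-w$, has a rational solution $(w,x,y,z)$ with $y\neq0$ and $0<w\le n$.
   Context: $\mathcal{N}_\theta$ denotes the set of natural numbers $n$ for which there exist positive rationals $a,b,c,d,e$ with $a^2+b^2-\frac{2s}{r}ab=c^2$, $a^2+d^2+\frac{2s}{r}ad=e^2$, and $a(b+d)=rn$. *)

theory Defs
  imports Complex_Main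
begin

definition N_theta :: "int \<Rightarrow> int \<Rightarrow> nat set" where
  "N_theta r s = {n. \<exists>a b c d e :: rat.
      a > 0 \<and> b > 0 \<and> c > 0 \<and> d > 0 \<and> e > 0 \<and>
      a^2 + b^2 - 2 * (of_int s / of_int r) * a * b = c^2 \<and>
      a^2 + d^2 + 2 * (of_int s / of_int r) * a * d = e^2 \<and>
      a * (b + d) = of_int r * of_nat n}"

end

theory Submission
  imports Defs
begin

text \<open>
  Put \<open>D = r\<^sup>2 - s\<^sup>2\<close>. The two sides correspond through \<open>w = 2ab/r\<close>, \<open>a = \<bar>y/(2x)\<bar>\<close>; on the curve
  the condition \<open>w \<le> n\<close> becomes \<open>b \<le> d\<close>, which is not automatic. But \<open>a, b, c, d, e\<close> describe a
  triangle with sides \<open>c\<close>, \<open>e\<close>, \<open>b + d\<close> and area \<open>n \<surd>D / 2\<close>, cut by a cevian \<open>a\<close> that meets the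
  base at the angle \<open>\<theta>\<close>, and in every rational triangle of this area such a cevian is rational.
  Writing the sides as \<open>x + z\<close>, \<open>x + y\<close>, \<open>y + z\<close>, Heron's formula asks for \<open>xyz(x + y + z) = n\<^sup>2 D / 4\<close>,
  and Euler found a one-parameter family of positive rational solutions. Near one end of the
  family the triangle degenerates in such a way that the foot of the cevian lies in the required
  half of the base, whatever \<open>\<theta>\<close> is. So both sides hold for every \<open>n > 0\<close>.
\<close>

section \<open>Euler's family of rational triangles with prescribed squared area\<close>

text \<open>Supplies a rational Euler parameter \<open>t\<close> with \<alpha> \<open>t ^ 4\<close>
  just above 2: take real fourth roots and use density of the rationals.\<close>

lemma rat_fourth_power_between:
  fixes l u :: rat
  assumes "0 \<le> l" "l < u"
  obtains t :: rat where "0 < t" "l < t ^ 4" "t ^ 4 < u"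
proof -
  have "root 4 (of_rat l) < root 4 (of_rat u)"
    using assms by (simp add: of_rat_less)
  then obtain t :: rat where t: "root 4 (of_rat l) < of_rat t" "of_rat t < root 4 (of_rat u)"
    using of_rat_dense by blast
  have l0: "0 \<le> root 4 (of_rat l)"
    using assms by simp
  then have "0 < (of_rat t :: real)"
    using t(1) by linarith
  then have t0: "0 < t" by simp
  have "root 4 (of_rat l) ^ 4 < (of_rat t :: real) ^ 4"
    using t(1) l0 by (intro power_strict_mono) auto
  then have lt: "l < t ^ 4"
    using assms by (simp add: of_rat_less flip: of_rat_power)
  have "(of_rat t :: real) ^ 4 < root 4 (of_rat u) ^ 4"
    using t(2) t0 by (intro power_strict_mono) auto
  then have "t ^ 4 < u"
    using assms by (simp add: of_rat_less flip: of_rat_power)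
  with t0 lt show thesis by (rule that)
qed

text \<open>With \<tau> = \<alpha> \<open>t ^ 4\<close>, everything rests on
  \<open>4 * \<tau> * A ^ 3 + B ^ 3 = C^2\<close> and \<open>B - 4 * A = 9\<close>: together they
  collapse \<open>x + y + z\<close> to \<open>C / (6 * t * A)\<close>, the reciprocal of
  \<open>x * y * z\<close> up to the factor \<alpha>.\<close>

lemma euler_identity:
  fixes \<alpha> t A B C x y z :: "'a::field_char_0"
  assumes nz: "t \<noteq> 0" "A \<noteq> 0" "B \<noteq> 0" "C \<noteq> 0"
    and A: "A = \<alpha> * t ^ 4 - 2" and B: "B = 4 * \<alpha> * t ^ 4 + 1"
    and C: "C = 2 * (\<alpha> * t ^ 4)\<^sup>2 + 10 * \<alpha> * t ^ 4 - 1"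
    and x: "x = 6 * \<alpha> * t ^ 3 * A\<^sup>2 / (B * C)"
    and y: "y = 3 * B\<^sup>2 / (2 * t * A * C)"
    and z: "z = 2 * C / (3 * t * B)"
  shows "x * y * z * (x + y + z) = \<alpha>"
proof -
  have AB: "B - 4 * A = 9"
    unfolding A B by (simp add: algebra_simps)
  have "4 * (\<alpha> * t ^ 4) * A ^ 3 + B ^ 3 = C\<^sup>2"
    unfolding A B C by algebra
  then have "36 * (\<alpha> * t ^ 4) * A ^ 3 + 9 * B ^ 3 = (B - 4 * A) * C\<^sup>2"
    unfolding AB by algebra
  then have key: "36 * \<alpha> * t ^ 4 * A ^ 3 + 9 * B ^ 3 + 4 * A * C\<^sup>2 = B * C\<^sup>2"
    by algebra
  have "x + y + z = (36 * \<alpha> * t ^ 4 * A ^ 3 + 9 * B ^ 3 + 4 * A * C\<^sup>2) / (6 * t * A * B * C)"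
    unfolding x y z using nz by (simp add: divide_simps) algebra
  also have "\<dots> = C / (6 * t * A)"
    unfolding key using nz by (simp add: divide_simps power2_eq_square)
  finally have sum: "x + y + z = C / (6 * t * A)" .
  have prod: "x * y * z = 6 * \<alpha> * t * A / C"
    unfolding x y z using nz by (simp add: divide_simps) algebra
  show ?thesis
    unfolding sum prod using nz by (simp add: divide_simps)
qed

text \<open>
  The family degenerates as \<open>\<alpha> t\<^sup>4\<close> decreases to \<open>2\<close>: then \<open>x\<close> tends to \<open>0\<close>, \<open>z\<close> to a positive limit
  and \<open>y\<close> to infinity.
\<close>

lemma euler_degenerating_solution:
  fixes \<alpha> K :: rat
  assumes "0 < \<alpha>" "0 < K"
  obtains x y z where "0 < x" "0 < y" "0 < z" "x * y * z * (x + y + z) = \<alpha>"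
    "2 * x \<le> z" "2 * z \<le> y" "K \<le> y * z"
proof -
  \<comment> \<open>The bound \<open>1/4\<close> keeps \<tau> below 3 and serves the two ratio
    estimates; the other bound forces \<open>K \<le> y * z\<close>, since
    \<open>y * z = B / (t^2 * A)\<close> with \<open>A \<le> \<delta>\<close>,
    \<open>9 \<le> B\<close> and \<open>t^2 \<le> 1 + 3 / \<alpha>\<close>.\<close>
  define \<delta> where "\<delta> = min (1/4) (9 / (K * (1 + 3 / \<alpha>)))"
  have "0 < K * (1 + 3 / \<alpha>)"
    using assms by (intro mult_pos_pos add_pos_pos) auto
  then have d0: "0 < \<delta>" and d1: "\<delta> \<le> 1/4" and d2: "\<delta> \<le> 9 / (K * (1 + 3 / \<alpha>))"
    unfolding \<delta>_def by simp_all
  obtain t where t: "0 < t" "2 / \<alpha> < t ^ 4" "t ^ 4 < (2 + \<delta>) / \<alpha>"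
    using rat_fourth_power_between[of "2/\<alpha>" "(2 + \<delta>) / \<alpha>"] assms d0
    by (auto simp: divide_strict_right_mono)
  define \<tau> where "\<tau> = \<alpha> * t ^ 4"
  have \<tau>: "2 < \<tau>" "\<tau> < 2 + \<delta>"
    using t assms by (auto simp: \<tau>_def field_simps)
  define A where "A = \<tau> - 2"
  define B where "B = 4 * \<tau> + 1"
  define C where "C = 2 * \<tau>\<^sup>2 + 10 * \<tau> - 1"
  have A: "0 < A" "A \<le> \<delta>" "A \<le> 1/4" and B: "9 \<le> B"
    using \<tau> d1 by (auto simp: A_def B_def)
  have \<tau>3: "\<tau> \<le> 3"
    using \<tau> d1 by linarith
  have sq: "2\<^sup>2 \<le> \<tau>\<^sup>2" "\<tau>\<^sup>2 \<le> 3\<^sup>2"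
    using \<tau> \<tau>3 by (intro power_mono; simp)+
  then have C: "27 \<le> C" "C \<le> 47"
    unfolding C_def using \<tau> \<tau>3 by auto
  have C2: "27\<^sup>2 \<le> C\<^sup>2" "C\<^sup>2 \<le> 47\<^sup>2"
    using C by (intro power_mono; simp)+
  have nz: "t \<noteq> 0" "A \<noteq> 0" "B \<noteq> 0" "C \<noteq> 0"
    using t A B C by auto
  define x where "x = 6 * \<alpha> * t ^ 3 * A\<^sup>2 / (B * C)"
  define y where "y = 3 * B\<^sup>2 / (2 * t * A * C)"
  define z where "z = 2 * C / (3 * t * B)"
  have pos: "0 < x" "0 < y" "0 < z"
    unfolding x_def y_def z_def using t A B C assms
    by (auto intro!: divide_pos_pos mult_pos_pos zero_less_power)
  have eq: "x * y * z * (x + y + z) = \<alpha>"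
    by (rule euler_identity[OF nz]) (auto simp: A_def B_def C_def \<tau>_def x_def y_def z_def mult.assoc)
  \<comment> \<open>In the ratios \<open>x / z\<close> and \<open>y / z\<close> the parameter
    \<open>t\<close> survives only through \<tau>, so the bounds on \<open>A\<close>,
    \<open>B\<close>, \<open>C\<close> decide both comparisons.\<close>
  have "x * C\<^sup>2 = z * (9 * \<tau> * A\<^sup>2)"
    unfolding x_def z_def \<tau>_def using nz by (simp add: divide_simps) algebra
  moreover have "9 * \<tau> * A\<^sup>2 \<le> 27 * 1"
    using \<tau> \<tau>3 A by (intro mult_mono) (auto simp: power_le_one)
  then have "z * (9 * \<tau> * A\<^sup>2) \<le> z * (27 * 1)"
    using pos by (intro mult_left_mono) auto
  moreover have "x * 27\<^sup>2 \<le> x * C\<^sup>2"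
    using C2 pos by (intro mult_left_mono) auto
  ultimately have "x * 27\<^sup>2 \<le> z * 27"
    by linarith
  then have zx: "2 * x \<le> z"
    using pos by simp
  have "y * (4 * A * C\<^sup>2) = z * (9 * B ^ 3)"
    unfolding y_def z_def using nz by (simp add: divide_simps) algebra
  moreover have "9 ^ 3 \<le> B ^ 3"
    using B by (intro power_mono) auto
  then have "z * (9 * 9 ^ 3) \<le> z * (9 * B ^ 3)"
    using pos by simp
  moreover have "4 * A * C\<^sup>2 \<le> 1 * 47\<^sup>2"
    using A C2 by (intro mult_mono) auto
  then have "y * (4 * A * C\<^sup>2) \<le> y * (1 * 47\<^sup>2)"
    using pos by (intro mult_left_mono) auto
  ultimately have "z * (9 * 9 ^ 3) \<le> y * (1 * 47\<^sup>2)"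
    by linarith
  then have yz: "2 * z \<le> y"
    using pos by simp
  have "t\<^sup>2 \<le> 1 + t ^ 4"
  proof -
    have "0 \<le> (t\<^sup>2 - 1/2)\<^sup>2" by simp
    then show ?thesis
      by (simp add: power2_diff power_divide flip: power_mult)
  qed
  also have "t ^ 4 \<le> 3 / \<alpha>"
    using \<tau>3 assms by (simp add: \<tau>_def field_simps)
  finally have "t\<^sup>2 \<le> 1 + 3 / \<alpha>" by simp
  then have "A * (K * t\<^sup>2) \<le> A * (K * (1 + 3 / \<alpha>))"
    using A assms by simp
  also have "\<dots> \<le> 9 / (K * (1 + 3 / \<alpha>)) * (K * (1 + 3 / \<alpha>))"
    using A d2 assms by (intro mult_right_mono) auto
  also have "\<dots> = 9"
    using assms by (simp add: add_pos_pos less_imp_neq[symmetric])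
  finally have "K * (t\<^sup>2 * A) \<le> B"
    using B by (simp add: ac_simps)
  moreover have "y * z = B / (t\<^sup>2 * A)"
    unfolding y_def z_def using nz by (simp add: divide_simps power2_eq_square)
  ultimately have "K \<le> y * z"
    using t A by (simp add: pos_le_divide_eq)
  with pos eq zx yz show thesis by (intro that)
qed

section \<open>From the triangle to the cevian\<close>

lemma rational_cevian:
  fixes R S n :: rat
  assumes S: "\<bar>S\<bar> < R" and n: "0 < n"
  obtains a b c d e where "0 < a" "0 < b" "0 < c" "0 < d" "0 < e"
    "a\<^sup>2 + b\<^sup>2 - 2 * (S / R) * a * b = c\<^sup>2"
    "a\<^sup>2 + d\<^sup>2 + 2 * (S / R) * a * d = e\<^sup>2"
    "a * (b + d) = R * n" "b \<le> d"
proof -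
  have R: "0 < R" using S by linarith
  have D: "0 < R\<^sup>2 - S\<^sup>2"
    using S abs_square_less_1[of "S / R"] R by (simp add: power_divide field_simps abs_less_iff)
  define \<alpha> where "\<alpha> = n\<^sup>2 * (R\<^sup>2 - S\<^sup>2) / 4"
  \<comment> \<open>Since \<open>\<bar>2 * S * n\<bar> < 2 * R * n \<le> y * z\<close>, the shift of
    the foot caused by the slant of the cevian is dominated: \<open>xz\<close> will give
    \<open>0 < b\<close> and \<open>zy\<close> will give \<open>b \<le> d\<close>.\<close>
  obtain x y z where pos: "0 < x" "0 < y" "0 < z" and eq: "x * y * z * (x + y + z) = \<alpha>"
    and xz: "2 * x \<le> z" and zy: "2 * z \<le> y" and K: "2 * R * n \<le> y * z"
    using euler_degenerating_solution[of \<alpha> "2 * R * n"] D n R by (auto simp: \<alpha>_def)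
  define L where "L = y + z"
  define c where "c = x + z"
  define e where "e = x + y"
  \<comment> \<open>Here \<open>L\<close> is the base and \<open>S / R\<close> the cosine of the
    angle; the area \<open>a * L * sqrt (R^2 - S^2) / (2 * R)\<close> must equal
    \<open>n * sqrt (R^2 - S^2) / 2\<close>. Next, \<open>p\<close> is the projection of the side
    \<open>c\<close> on the base.\<close>
  define a where "a = R * n / L"
  define p where "p = (c\<^sup>2 + L\<^sup>2 - e\<^sup>2) / (2 * L)"
  define b where "b = p + S / R * a"
  define d where "d = L - b"
  have L: "0 < L" using pos by (simp add: L_def)
  have a: "0 < a" using R n L by (simp add: a_def)
  have Sn: "\<bar>S * n\<bar> < R * n"
    using S n by (simp add: abs_mult)
  have Lb: "2 * L * b = c\<^sup>2 + L\<^sup>2 - e\<^sup>2 + 2 * (S * n)"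
    unfolding b_def p_def a_def using L R by (simp add: field_simps)
  \<comment> \<open>The right side is \<open>(L - e) * (L + e)\<close>; the later estimate uses
    \<open>(e - c) * (e + c)\<close> in the same way.\<close>
  have "(z / 2) * (2 * y) \<le> (z - x) * (x + 2 * y + z)"
    using pos xz by (intro mult_mono) auto
  then have "y * z \<le> L\<^sup>2 - e\<^sup>2"
    by (simp add: L_def e_def power2_eq_square algebra_simps)
  moreover have "0 < c\<^sup>2" using pos by (simp add: c_def)
  ultimately have "0 < 2 * L * b"
    unfolding Lb using K Sn by linarith
  then have b: "0 < b" using L by (simp add: zero_less_mult_iff)
  have "z * y \<le> (y - z) * (y + (z + 2 * x))"
    using pos zy by (intro mult_mono) auto
  then have "y * z \<le> e\<^sup>2 - c\<^sup>2"
    by (simp add: c_def e_def power2_eq_square algebra_simps)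
  then have "2 * L * b \<le> L\<^sup>2"
    unfolding Lb using K Sn by linarith
  then have "2 * b \<le> L"
    using L by (simp add: power2_eq_square mult.assoc mult.left_commute)
  then have bd: "b \<le> d" and d: "0 < d"
    using b by (auto simp: d_def)
  have aL: "a * L = R * n" using L by (simp add: a_def)
  have pL: "2 * (p * L) = c\<^sup>2 + L\<^sup>2 - e\<^sup>2" using L by (simp add: p_def)
  have heron: "4 * (c * L)\<^sup>2 - (c\<^sup>2 + L\<^sup>2 - e\<^sup>2)\<^sup>2 = 16 * \<alpha>"
    unfolding eq[symmetric] c_def e_def L_def by algebra
  \<comment> \<open>the square of the height of the triangle, computed from the cevian and from Heron's formula\<close>
  have h: "a\<^sup>2 * (1 - (S / R)\<^sup>2) = c\<^sup>2 - p\<^sup>2"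
  proof -
    have "L\<^sup>2 * (a\<^sup>2 * (1 - (S / R)\<^sup>2)) = (R * n)\<^sup>2 * (1 - (S / R)\<^sup>2)"
      unfolding aL[symmetric] by (simp add: power_mult_distrib)
    also have "\<dots> = 4 * \<alpha>"
      unfolding \<alpha>_def using R by (simp add: power_mult_distrib power_divide field_simps)
    also have "\<dots> = (c * L)\<^sup>2 - (p * L)\<^sup>2"
      using heron unfolding pL[symmetric] by (simp add: power_mult_distrib)
    also have "\<dots> = L\<^sup>2 * (c\<^sup>2 - p\<^sup>2)"
      by (simp add: power_mult_distrib algebra_simps)
    finally show ?thesis using L by simp
  qed
  \<comment> \<open>Both cosine laws are Pythagoras with the common height: the legs along the base
    are \<open>b - S / R * a = p\<close> and \<open>d + S / R * a = L - p\<close>.\<close>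
  have abc: "a\<^sup>2 + b\<^sup>2 - 2 * (S / R) * a * b = c\<^sup>2"
    using h unfolding b_def by algebra
  have ade: "a\<^sup>2 + d\<^sup>2 + 2 * (S / R) * a * d = e\<^sup>2"
    using h pL unfolding d_def b_def by algebra
  show thesis
  proof (rule that[OF a b _ d _ abc ade _ bd])
    show "0 < c" "0 < e" using pos by (auto simp: c_def e_def)
    show "a * (b + d) = R * n" using aL by (simp add: d_def)
  qed
qed

section \<open>Passage between cevians and points on the two curves\<close>

lemma cevian_imp_curve_point:
  fixes a b c d e R S n :: rat
  assumes S: "\<bar>S\<bar> < R" and pos: "0 < a" "0 < b" "0 < c"
    and abc: "a\<^sup>2 + b\<^sup>2 - 2 * (S / R) * a * b = c\<^sup>2"
    and ade: "a\<^sup>2 + d\<^sup>2 + 2 * (S / R) * a * d = e\<^sup>2"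
    and abd: "a * (b + d) = R * n" and bd: "b \<le> d"
  shows "\<exists>w x y z. y\<^sup>2 = x * (x + (R + S) * w) * (x - (R - S) * w) \<and>
    z\<^sup>2 = (x\<^sup>2 + 2 * S * ((2 * n - w) + w) * x - (R\<^sup>2 - S\<^sup>2) * w\<^sup>2)\<^sup>2
      + 4 * (R\<^sup>2 - S\<^sup>2) * (2 * n - w)\<^sup>2 * x\<^sup>2 \<and>
    y \<noteq> 0 \<and> 0 < w \<and> w \<le> n"
proof -
  have R: "0 < R" using S by linarith
  define w where "w = 2 * a * b / R"
  define N where "N = 2 * a * d / R"
  have w: "R * w = 2 * a * b" "0 < w" and N: "R * N = 2 * a * d"
    using R pos by (auto simp: w_def N_def)
  have "w + N = 2 * (a * (b + d)) / R"
    unfolding w_def N_def by (simp add: algebra_simps add_divide_distrib)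
  also have "\<dots> = 2 * n" unfolding abd using R by simp
  finally have wN: "2 * n - w = N" by simp
  have "w \<le> N"
    using bd pos R by (simp add: w_def N_def divide_right_mono)
  then have wn: "w \<le> n" using wN by linarith
  have Sb: "2 * (S / R) * a * b = S * w" and Sd: "2 * (S / R) * a * d = S * N"
    by (simp_all add: w_def N_def)
  have c: "c\<^sup>2 = a\<^sup>2 + b\<^sup>2 - S * w" and e: "e\<^sup>2 = a\<^sup>2 + d\<^sup>2 + S * N"
    using abc[unfolded Sb] ade[unfolded Sd] by simp_all
  \<comment> \<open>Putting \<open>y = 2 * a * x\<close> in the first curve leaves a quadratic in
    \<open>x\<close> whose reduced discriminant
    \<open>(2 * a^2 - S * w)^2 + (R^2 - S^2) * w^2\<close> is \<open>(2 * a * c)^2\<close>; this is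
    its positive root.\<close>
  define x where "x = 2 * a\<^sup>2 - S * w + 2 * a * c"
  have "(S / R)\<^sup>2 < 1"
    using S R by (simp add: abs_square_less_1)
  then have "(S / R * b)\<^sup>2 < b\<^sup>2"
    unfolding power_mult_distrib using pos by simp
  then have "(a - S / R * b)\<^sup>2 < c\<^sup>2"
    unfolding abc[symmetric] power2_diff by (simp add: algebra_simps)
  then have "\<bar>a - S / R * b\<bar> < c"
    using pos by (metis abs_of_pos power2_less_imp_less power2_abs less_imp_le)
  then have "0 < 2 * a * (a - S / R * b + c)"
    using pos by (intro mult_pos_pos) auto
  also have "\<dots> = x"
    unfolding x_def w_def using R by (simp add: field_simps power2_eq_square)
  finally have x: "0 < x" .
  have "(R\<^sup>2 - S\<^sup>2) * w\<^sup>2 = x * (2 * a * c - 2 * a\<^sup>2 + S * w)"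
    using w(1) c unfolding x_def by algebra
  then have y: "x\<^sup>2 + 2 * S * w * x - (R\<^sup>2 - S\<^sup>2) * w\<^sup>2 = 4 * a\<^sup>2 * x"
    unfolding x_def by algebra
  have E: "(2 * a * x)\<^sup>2 = x * (x + (R + S) * w) * (x - (R - S) * w)"
    using y by algebra
  have G: "(4 * x * a * e)\<^sup>2 = (x\<^sup>2 + 2 * S * (N + w) * x - (R\<^sup>2 - S\<^sup>2) * w\<^sup>2)\<^sup>2
      + 4 * (R\<^sup>2 - S\<^sup>2) * N\<^sup>2 * x\<^sup>2"
  proof -
    have "x\<^sup>2 + 2 * S * (N + w) * x - (R\<^sup>2 - S\<^sup>2) * w\<^sup>2 = (4 * a\<^sup>2 + 2 * S * N) * x"
      using y by algebra
    moreover have "16 * a\<^sup>2 * e\<^sup>2 = (4 * a\<^sup>2 + 2 * S * N)\<^sup>2 + 4 * (R\<^sup>2 - S\<^sup>2) * N\<^sup>2"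
      using e N by algebra
    ultimately show ?thesis by algebra
  qed
  have "2 * a * x \<noteq> 0" using pos x by simp
  with E G w(2) wn show ?thesis unfolding wN[symmetric] by blast
qed

text \<open>Inverts the previous substitution, with absolute values because \<open>x\<close>,
  \<open>y\<close>, \<open>z\<close> may be negative. The bound \<open>w \<le> n\<close> makes
  \<open>N\<close>, and hence \<open>d\<close>, positive.\<close>

lemma curve_point_imp_cevian:
  fixes w x y z R S n :: rat
  assumes S: "\<bar>S\<bar> < R"
    and y: "y\<^sup>2 = x * (x + (R + S) * w) * (x - (R - S) * w)"
    and z: "z\<^sup>2 = (x\<^sup>2 + 2 * S * ((2 * n - w) + w) * x - (R\<^sup>2 - S\<^sup>2) * w\<^sup>2)\<^sup>2
      + 4 * (R\<^sup>2 - S\<^sup>2) * (2 * n - w)\<^sup>2 * x\<^sup>2"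
    and y0: "y \<noteq> 0" and w: "0 < w" "w \<le> n"
  shows "\<exists>a b c d e. 0 < a \<and> 0 < b \<and> 0 < c \<and> 0 < d \<and> 0 < e \<and>
    a\<^sup>2 + b\<^sup>2 - 2 * (S / R) * a * b = c\<^sup>2 \<and>
    a\<^sup>2 + d\<^sup>2 + 2 * (S / R) * a * d = e\<^sup>2 \<and> a * (b + d) = R * n"
proof -
  have R: "0 < R" using S by linarith
  have D: "0 < R\<^sup>2 - S\<^sup>2"
    using S abs_square_less_1[of "S / R"] R by (simp add: power_divide field_simps abs_less_iff)
  have x: "x \<noteq> 0" using y y0 by auto
  define N where "N = 2 * n - w"
  have N: "0 < N" using w by (simp add: N_def)
  define a where "a = \<bar>y\<bar> / (2 * \<bar>x\<bar>)"
  define b where "b = R * w / (2 * a)"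
  \<comment> \<open>The first curve alone makes \<open>c\<close> rational, by
    \<open>(u - v)^2 + 4 * u * v = (u + v)^2\<close> with \<open>u = x^2\<close> and
    \<open>v = (R^2 - S^2) * w^2\<close>; the second curve supplies \<open>e\<close>.\<close>
  define c where "c = (x\<^sup>2 + (R\<^sup>2 - S\<^sup>2) * w\<^sup>2) / (4 * a * \<bar>x\<bar>)"
  define d where "d = R * N / (2 * a)"
  define e where "e = \<bar>z\<bar> / (4 * a * \<bar>x\<bar>)"
  have "0 < z\<^sup>2"
    unfolding z N_def[symmetric] using D N x by (intro add_nonneg_pos) auto
  then have z0: "z \<noteq> 0" by auto
  have a: "0 < a" using y0 x by (simp add: a_def)
  have b: "0 < b" and d: "0 < d" using R w N a by (auto simp: b_def d_def)
  have c: "0 < c"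
    unfolding c_def using D a x w by (intro divide_pos_pos add_pos_pos mult_pos_pos) auto
  have e: "0 < e" using a x z0 by (simp add: e_def)
  have ab: "2 * a * b = R * w" and ad: "2 * a * d = R * N"
    using a by (auto simp: b_def d_def)
  have "4 * a\<^sup>2 * x\<^sup>2 = y\<^sup>2"
    using x by (simp add: a_def power_divide power_mult_distrib)
  then have "x * (4 * a\<^sup>2 * x) = x * (x\<^sup>2 + 2 * S * w * x - (R\<^sup>2 - S\<^sup>2) * w\<^sup>2)"
    unfolding y by algebra
  then have ax: "4 * a\<^sup>2 * x = x\<^sup>2 + 2 * S * w * x - (R\<^sup>2 - S\<^sup>2) * w\<^sup>2"
    using x by simp
  have nz: "16 * a\<^sup>2 * x\<^sup>2 \<noteq> 0" using a x by simp
  have cc: "16 * a\<^sup>2 * x\<^sup>2 * c\<^sup>2 = (x\<^sup>2 + (R\<^sup>2 - S\<^sup>2) * w\<^sup>2)\<^sup>2"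
    unfolding c_def using a x by (simp add: power_divide power_mult_distrib)
  have ee: "16 * a\<^sup>2 * x\<^sup>2 * e\<^sup>2 = z\<^sup>2"
    unfolding e_def using a x by (simp add: power_divide power_mult_distrib)
  have Sb: "2 * (S / R) * a * b = S * w" and Sd: "2 * (S / R) * a * d = S * N"
    using ab ad R by (simp_all add: field_simps)
  have "16 * a\<^sup>2 * x\<^sup>2 * (a\<^sup>2 + b\<^sup>2 - S * w) = 16 * a\<^sup>2 * x\<^sup>2 * c\<^sup>2"
  proof -
    have "16 * a\<^sup>2 * x\<^sup>2 * (a\<^sup>2 + b\<^sup>2 - S * w)
        = (4 * a\<^sup>2 * x - 2 * S * w * x)\<^sup>2 + 4 * (R\<^sup>2 - S\<^sup>2) * w\<^sup>2 * x\<^sup>2"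
      using ab by algebra
    then show ?thesis unfolding cc ax by algebra
  qed
  then have abc: "a\<^sup>2 + b\<^sup>2 - 2 * (S / R) * a * b = c\<^sup>2"
    unfolding Sb using nz by simp
  have "16 * a\<^sup>2 * x\<^sup>2 * (a\<^sup>2 + d\<^sup>2 + S * N) = 16 * a\<^sup>2 * x\<^sup>2 * e\<^sup>2"
  proof -
    have "16 * a\<^sup>2 * x\<^sup>2 * (a\<^sup>2 + d\<^sup>2 + S * N)
        = (4 * a\<^sup>2 * x + 2 * S * N * x)\<^sup>2 + 4 * (R\<^sup>2 - S\<^sup>2) * N\<^sup>2 * x\<^sup>2"
      using ad by algebra
    then show ?thesis unfolding ee z N_def[symmetric] ax by algebra
  qed
  then have ade: "a\<^sup>2 + d\<^sup>2 + 2 * (S / R) * a * d = e\<^sup>2"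
    unfolding Sd using nz by simp
  have "2 * (a * (b + d)) = R * (w + N)"
    using ab ad by (simp add: algebra_simps)
  then have "a * (b + d) = R * n" by (simp add: N_def)
  with a b c d e abc ade show ?thesis by blast
qed

theorem theorem3p2:
  fixes \<theta> :: real and r s :: int and n :: nat
  assumes "0 < \<theta>" and "\<theta> < pi"
    and "cos \<theta> = real_of_int s / real_of_int r"
    and "0 \<le> \<bar>s\<bar>" and "\<bar>s\<bar> < r" and "gcd r s = 1"
  shows "n \<in> N_theta r s \<longleftrightarrow>
    (\<exists>w x y z :: rat.
       y^2 = x * (x + of_int (r + s) * w) * (x - of_int (r - s) * w) \<and>
       z^2 = (x^2 + 2 * of_int s * ((2 * of_nat n - w) + w) * x - of_int (r^2 - s^2) * w^2)^2
             + 4 * of_int (r^2 - s^2) * (2 * of_nat n - w)^2 * x^2 \<and>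
       y \<noteq> 0 \<and> 0 < w \<and> w \<le> of_nat n)"
    (is "_ \<longleftrightarrow> ?curve")
proof
  have S: "\<bar>of_int s\<bar> < (of_int r :: rat)"
    using assms(5) by (metis of_int_abs of_int_less_iff)
  {
    assume "n \<in> N_theta r s"
    then obtain a b d :: rat where "0 < a" "0 < b" "0 < d" "a * (b + d) = of_int r * of_nat n"
      unfolding N_theta_def by blast
    then have "of_int r * (of_nat n :: rat) \<noteq> 0"
      by (metis add_pos_pos mult_pos_pos less_irrefl)
    then have n: "0 < (of_nat n :: rat)" by simp
    \<comment> \<open>The given solution is replaced by a fresh one, as it may have
      \<open>d < b\<close>; exchanging \<open>b\<close> and \<open>d\<close> would change the sign
      of \<open>s\<close>.\<close>
    obtain a b c d e :: rat where "0 < a" "0 < b" "0 < c"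
      "a\<^sup>2 + b\<^sup>2 - 2 * (of_int s / of_int r) * a * b = c\<^sup>2"
      "a\<^sup>2 + d\<^sup>2 + 2 * (of_int s / of_int r) * a * d = e\<^sup>2"
      "a * (b + d) = of_int r * of_nat n" "b \<le> d"
      using rational_cevian[OF S n] by metis
    from cevian_imp_curve_point[OF S this] show ?curve
      by (simp only: of_int_add of_int_diff of_int_power)
  }
  assume ?curve
  then obtain w x y z :: rat where
    "y\<^sup>2 = x * (x + (of_int r + of_int s) * w) * (x - (of_int r - of_int s) * w)"
    "z\<^sup>2 = (x\<^sup>2 + 2 * of_int s * ((2 * of_nat n - w) + w) * x
        - ((of_int r)\<^sup>2 - (of_int s)\<^sup>2) * w\<^sup>2)\<^sup>2
      + 4 * ((of_int r)\<^sup>2 - (of_int s)\<^sup>2) * (2 * of_nat n - w)\<^sup>2 * x\<^sup>2"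
    "y \<noteq> 0" "0 < w" "w \<le> of_nat n"
    by (simp only: of_int_add of_int_diff of_int_power) blast
  from curve_point_imp_cevian[OF S this] show "n \<in> N_theta r s"
    unfolding N_theta_def by simp
qed

end
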